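(* Let $A_1,A_2\in\mathbb{R}^{n\times n}$, $e_1,e_2,c\in\mathbb{R}^n$ and $f\in\mathbb{R}$. Let $G:\mathbb{R}^n\rightrightarrows\mathbb{R}^n$ be the set-valued mapping $$G(x)=\begin{cases}\{A_1x+e_1\} & \text{if } c^Tx+f<0,\\ \operatorname{conv}(\{A_1x+e_1,\,A_2x+e_2\}) & \text{if } c^Tx+f=0,\\ \{A_2x+e_2\} & \text{if } c^Tx+f>0.\end{cases}$$ Then $G$ is one-sided Lipschitz if and only if there exist a vector $g\in\mathbb{R}^n$ and a number $\mu\geq 0$ such that $$A_1-A_2=g c^T\quad\text{and}\quad e_1-e_2=f g+\mu c.$$
   Context: $\operatorname{conv}$ denotes the convex hull. A set-valued mapping $H:\mathbb{R}^n\rightrightarrows\mathbb{R}^n$ is said to be one-sided Lipschitz if there exists a number $L$ such that $(x_1-x_2)^T(y_1-y_2)\leq L\|x_1-x_2\|^2$ for all $x_1,x_2$ belonging to the domain of $H$, all $y_1\in H(x_1)$ and all $y_2\in H(x_2)$.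
   Formalization: The case c = 0, f ≠ 0 is excluded: there only one mode is active, so G is always one-sided Lipschitz, and the claim fails, e.g. for n = 1, c = 0, f = −1, A_1 = 1, A_2 = 0, e_1 = e_2 = 0. *)

theory Defs
  imports "HOL-Analysis.Analysis"
begin

(* A set-valued mapping is a function into sets; its domain is the set of points
   where its value is nonempty. *)

definition set_valued_domain :: "('a \<Rightarrow> 'b set) \<Rightarrow> 'a set" where
  "set_valued_domain H = {x. H x \<noteq> {}}"

definition one_sided_lipschitz :: "(real^'n \<Rightarrow> (real^'n) set) \<Rightarrow> bool" where
  "one_sided_lipschitz H \<longleftrightarrow>
     (\<exists>L::real. \<forall>x1 \<in> set_valued_domain H. \<forall>x2 \<in> set_valued_domain H.
        \<forall>y1 \<in> H x1. \<forall>y2 \<in> H x2.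
          (x1 - x2) \<bullet> (y1 - y2) \<le> L * (norm (x1 - x2))\<^sup>2)"

definition bimodal_map ::
  "real^'n^'n \<Rightarrow> real^'n^'n \<Rightarrow> real^'n \<Rightarrow> real^'n \<Rightarrow> real^'n \<Rightarrow> real \<Rightarrow> real^'n \<Rightarrow> (real^'n) set" where
  "bimodal_map A1 A2 e1 e2 c f x =
     (if c \<bullet> x + f < 0 then {A1 *v x + e1}
      else if c \<bullet> x + f = 0 then convex hull {A1 *v x + e1, A2 *v x + e2}
      else {A2 *v x + e2})"

end

theory Submission
  imports Defs
begin

text \<open>
  Put \<open>s x = c \<bullet> x + f\<close> and \<open>h x = (A1 - A2) x + (e1 - e2)\<close>, the jump of the mapping across the
  hyperplane \<open>s = 0\<close>. The values of the mapping are \<open>A2 x + e2 + \<theta> h x\<close>, where \<open>\<theta> \<in> [0,1]\<close> is a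
  nonincreasing (multivalued) step function of \<open>s x\<close>. If \<open>h x = s x g + \<mu> c\<close> with \<open>\<mu> \<ge> 0\<close>, then
  \<open>\<theta> s x = min (s x) 0\<close> is a Lipschitz function of \<open>x\<close>, and the remaining term
  \<open>\<theta> \<mu> c\<close> contributes a nonpositive amount. Conversely, comparing the two branches at \<open>x\<close> and at
  \<open>x + t w\<close> for \<open>t\<close> tending to 0 shows \<open>w \<bullet> h x \<le> 0\<close> whenever \<open>s x = 0\<close> and \<open>c \<bullet> w \<le> 0\<close>, so
  \<open>h x\<close> is a nonnegative multiple of \<open>c\<close> on the whole hyperplane. An affine function with
  values in a ray is constant, so \<open>A1 - A2\<close> vanishes on the orthogonal complement of \<open>c\<close>.
\<close>

text \<open>Turns the outer product into a pointwise identity, so the rest of the argument uses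
  inner products only.\<close>

lemma matrix_eq_column_row_iff:
  fixes D :: "real^'n^'m"
  shows "D = (columnvector g :: real^1^'m) ** (rowvector c :: real^'n^1) \<longleftrightarrow>
    (\<forall>x. D *v x = (c \<bullet> x) *\<^sub>R g)"
proof -
  have "((columnvector g :: real^1^'m) ** (rowvector c :: real^'n^1)) *v x = (c \<bullet> x) *\<^sub>R g" for x
    by (simp add: vec_eq_iff matrix_vector_mult_def matrix_matrix_mult_def columnvector_def
        rowvector_def inner_vec_def sum_distrib_left sum_distrib_right algebra_simps)
  then show ?thesis
    by (simp add: matrix_eq)
qed

lemma one_sided_lipschitz_iff:
  "one_sided_lipschitz H \<longleftrightarrow>
    (\<exists>L. \<forall>x1 x2. \<forall>y1 \<in> H x1. \<forall>y2 \<in> H x2. (x1 - x2) \<bullet> (y1 - y2) \<le> L * (norm (x1 - x2))\<^sup>2)"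
  unfolding one_sided_lipschitz_def set_valued_domain_def by (rule ex_cong1) blast

lemma bimodal_map_left: "c \<bullet> x + f \<le> 0 \<Longrightarrow> A1 *v x + e1 \<in> bimodal_map A1 A2 e1 e2 c f x"
  by (auto simp: bimodal_map_def intro: hull_inc)

lemma bimodal_map_right: "c \<bullet> x + f \<ge> 0 \<Longrightarrow> A2 *v x + e2 \<in> bimodal_map A1 A2 e1 e2 c f x"
  by (auto simp: bimodal_map_def intro: hull_inc)

lemma bimodal_mapE:
  assumes "y \<in> bimodal_map A1 A2 e1 e2 c f x"
  obtains \<theta> where "0 \<le> \<theta>" "\<theta> \<le> 1" "c \<bullet> x + f < 0 \<Longrightarrow> \<theta> = 1" "c \<bullet> x + f > 0 \<Longrightarrow> \<theta> = 0"
    "y = A2 *v x + e2 + \<theta> *\<^sub>R ((A1 - A2) *v x + (e1 - e2))"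
proof (cases "c \<bullet> x + f" "0 :: real" rule: linorder_cases)
  case less
  with assms that[of 1] show ?thesis
    by (simp add: bimodal_map_def algebra_simps)
next
  case greater
  with assms that[of 0] show ?thesis
    by (simp add: bimodal_map_def)
next
  case equal
  with assms obtain u v where uv: "0 \<le> u" "0 \<le> v" "u + v = 1"
    "y = u *\<^sub>R (A1 *v x + e1) + v *\<^sub>R (A2 *v x + e2)"
    by (auto simp: bimodal_map_def convex_hull_2)
  then have v: "v = 1 - u"
    by simp
  with uv equal that[of u] show ?thesis
    by (simp add: algebra_simps)
qed

lemma nonpos_if_le_mult_pos:
  fixes a b :: real
  assumes "\<And>t. t > 0 \<Longrightarrow> a \<le> t * b"
  shows "a \<le> 0"
proof (rule tendsto_lowerbound)
  show "((\<lambda>t. t * b) \<longlongrightarrow> 0) (at_right 0)"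
    by (auto intro!: tendsto_eq_intros)
  show "eventually (\<lambda>t. a \<le> t * b) (at_right 0)"
    using assms by (auto simp: eventually_at_filter)
qed simp

lemma affine_nonneg_imp_slope_zero:
  fixes a b :: real
  assumes "\<And>t. 0 \<le> a + t * b"
  shows "b = 0"
proof (rule ccontr)
  assume "b \<noteq> 0"
  \<comment> \<open>At this parameter the affine function takes the value -1.\<close>
  with assms[of "- (a + 1) / b"] show False
    by simp
qed

lemma jump_inner_nonpos:
  assumes osl: "one_sided_lipschitz (bimodal_map A1 A2 e1 e2 c f)"
    and x: "c \<bullet> x + f = 0" and w: "c \<bullet> w \<le> 0"
  shows "w \<bullet> ((A1 - A2) *v x + (e1 - e2)) \<le> 0"
proof -
  obtain L where L: "\<And>x1 x2 y1 y2. y1 \<in> bimodal_map A1 A2 e1 e2 c f x1 \<Longrightarrow>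
      y2 \<in> bimodal_map A1 A2 e1 e2 c f x2 \<Longrightarrow>
      (x1 - x2) \<bullet> (y1 - y2) \<le> L * (norm (x1 - x2))\<^sup>2"
    using osl unfolding one_sided_lipschitz_iff by blast
  show ?thesis
  proof (rule nonpos_if_le_mult_pos)
    fix t :: real
    assume t: "t > 0"
    \<comment> \<open>So the first branch is a value at \<open>x + t *\<^sub>R w\<close>, while the
      second is a value at \<open>x\<close>, which lies on the hyperplane.\<close>
    have "c \<bullet> (x + t *\<^sub>R w) + f \<le> 0"
      using x mult_nonneg_nonpos[of t, OF _ w] t by (simp add: inner_add_right)
    from L[OF bimodal_map_left[OF this] bimodal_map_right[of c x f]] x
    have "(t *\<^sub>R w) \<bullet> (A1 *v (x + t *\<^sub>R w) + e1 - (A2 *v x + e2)) \<le> L * (norm (t *\<^sub>R w))\<^sup>2"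
      by simp
    also have "A1 *v (x + t *\<^sub>R w) + e1 - (A2 *v x + e2) =
        (A1 - A2) *v x + (e1 - e2) + t *\<^sub>R (A1 *v w)"
      by (simp add: algebra_simps)
    finally have "t * (w \<bullet> ((A1 - A2) *v x + (e1 - e2))) \<le>
        t * (t * (L * (norm w)\<^sup>2 - w \<bullet> (A1 *v w)))"
      by (simp add: inner_add_right power_mult_distrib power2_eq_square algebra_simps)
    with t show "w \<bullet> ((A1 - A2) *v x + (e1 - e2)) \<le> t * (L * (norm w)\<^sup>2 - w \<bullet> (A1 *v w))"
      by simp
  qed
qed

text \<open>For \<open>c = 0\<close> the quotient is 0 and the conclusion reads \<open>h = 0\<close>.\<close>

lemma eq_nonneg_multiple_if_halfspace:
  fixes c h :: "'a::real_inner"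
  assumes "\<And>w. c \<bullet> w \<le> 0 \<Longrightarrow> w \<bullet> h \<le> 0"
  shows "c \<bullet> h \<ge> 0" "h = (c \<bullet> h / (c \<bullet> c)) *\<^sub>R c"
proof -
  show "c \<bullet> h \<ge> 0"
    using assms[of "- c"] by simp
  \<comment> \<open>The component of \<open>h\<close> orthogonal to \<open>c\<close> is itself an
    admissible test direction.\<close>
  define w where "w = h - (c \<bullet> h / (c \<bullet> c)) *\<^sub>R c"
  have cw: "c \<bullet> w = 0"
    by (simp add: w_def inner_diff_right)
  then have "w \<bullet> h \<le> 0"
    by (intro assms) simp
  moreover have "w \<bullet> w = w \<bullet> h"
    using cw by (subst (2) w_def) (simp add: inner_diff_right inner_commute)
  ultimately have "w = 0"
    by (metis inner_eq_zero_iff inner_ge_zero order_antisym)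
  then show "h = (c \<bullet> h / (c \<bullet> c)) *\<^sub>R c"
    by (simp add: w_def)
qed

lemma rank_one_jump_if_one_sided_lipschitz:
  fixes A1 A2 :: "real^'n^'n" and e1 e2 c :: "real^'n" and f :: real
  assumes osl: "one_sided_lipschitz (bimodal_map A1 A2 e1 e2 c f)" and cf: "c = 0 \<longrightarrow> f = 0"
  obtains g :: "real^'n" and \<mu> :: real
  where "\<mu> \<ge> 0" "\<And>x. (A1 - A2) *v x = (c \<bullet> x) *\<^sub>R g" "e1 - e2 = f *\<^sub>R g + \<mu> *\<^sub>R c"
proof -
  define h where "h x = (A1 - A2) *v x + (e1 - e2)" for x
  have hnn: "c \<bullet> h x \<ge> 0" and hc: "h x = (c \<bullet> h x / (c \<bullet> c)) *\<^sub>R c" if "c \<bullet> x + f = 0" for x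
    using eq_nonneg_multiple_if_halfspace[of c "h x"] jump_inner_nonpos[OF osl that]
    unfolding h_def by blast+
  \<comment> \<open>Foot of the perpendicular from the origin to the hyperplane. If
    \<open>c = 0\<close>, division by zero gives \<open>x0 = 0\<close>, and \<open>cf\<close> gives
    \<open>f = 0\<close>.\<close>
  define x0 where "x0 = - (f / (c \<bullet> c)) *\<^sub>R c"
  have cx0: "c \<bullet> x0 = - f"
    using cf by (auto simp: x0_def)
  have h_shift: "h (x0 + v) = h x0 + (A1 - A2) *v v" for v
    by (simp add: h_def matrix_vector_right_distrib)
  have kernel: "(A1 - A2) *v v = 0" if v: "c \<bullet> v = 0" for v
  proof -
    \<comment> \<open>The line \<open>x0 + t *\<^sub>R v\<close> stays in the hyperplane for all
      real \<open>t\<close>.\<close>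
    have "0 \<le> c \<bullet> h x0 + t * (c \<bullet> ((A1 - A2) *v v))" for t
      using hnn[of "x0 + t *\<^sub>R v"] v cx0
      by (simp add: h_shift inner_add_right matrix_vector_mult_scaleR)
    then have "c \<bullet> ((A1 - A2) *v v) = 0"
      by (rule affine_nonneg_imp_slope_zero)
    then have "h (x0 + v) = h x0"
      using hc[of "x0 + v"] hc[of x0] v cx0 by (simp add: h_shift inner_add_right)
    then show ?thesis
      by (simp add: h_shift)
  qed
  \<comment> \<open>For nonzero \<open>c\<close> this is forced by testing the desired identity at
    \<open>x = c\<close>.\<close>
  define g where "g = (1 / (c \<bullet> c)) *\<^sub>R ((A1 - A2) *v c)"
  have D: "(A1 - A2) *v x = (c \<bullet> x) *\<^sub>R g" for x
  proof -
    have "(A1 - A2) *v (x - (c \<bullet> x / (c \<bullet> c)) *\<^sub>R c) = 0"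
      by (rule kernel) (simp add: inner_diff_right)
    then show ?thesis
      by (simp add: g_def matrix_vector_mult_diff_distrib matrix_vector_mult_scaleR)
  qed
  have "e1 - e2 = f *\<^sub>R g + (c \<bullet> h x0 / (c \<bullet> c)) *\<^sub>R c"
  proof -
    have "h x0 = (e1 - e2) - f *\<^sub>R g"
      by (simp add: h_def D cx0)
    moreover have "h x0 = (c \<bullet> h x0 / (c \<bullet> c)) *\<^sub>R c"
      using cx0 by (intro hc) simp
    ultimately show ?thesis
      by (metis add.commute diff_add_cancel)
  qed
  moreover have "c \<bullet> h x0 / (c \<bullet> c) \<ge> 0"
    using hnn[of x0] cx0 by simp
  ultimately show thesis
    using that D by blast
qed

lemma one_sided_lipschitz_if_rank_one_jump:
  fixes A1 A2 :: "real^'n^'n" and e1 e2 c g :: "real^'n" and f \<mu> :: real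
  assumes \<mu>: "\<mu> \<ge> 0" and D: "\<And>x. (A1 - A2) *v x = (c \<bullet> x) *\<^sub>R g"
    and d: "e1 - e2 = f *\<^sub>R g + \<mu> *\<^sub>R c"
  shows "one_sided_lipschitz (bimodal_map A1 A2 e1 e2 c f)"
proof -
  \<comment> \<open>The first summand bounds the common linear part, the second the term
    \<open>min (s x) 0\<close> times \<open>g\<close>.\<close>
  define L where "L = onorm ((*v) A2) + norm c * norm g"
  have "(x1 - x2) \<bullet> (y1 - y2) \<le> L * (norm (x1 - x2))\<^sup>2"
    if y1: "y1 \<in> bimodal_map A1 A2 e1 e2 c f x1" and y2: "y2 \<in> bimodal_map A1 A2 e1 e2 c f x2"
    for x1 x2 y1 y2
  proof -
    define s where "s x = c \<bullet> x + f" for x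
    define z where "z = x1 - x2"
    have h: "(A1 - A2) *v x + (e1 - e2) = s x *\<^sub>R g + \<mu> *\<^sub>R c" for x
      unfolding D d by (simp add: s_def algebra_simps)
    from y1 obtain p where p: "0 \<le> p" "p \<le> 1" "s x1 < 0 \<Longrightarrow> p = 1" "s x1 > 0 \<Longrightarrow> p = 0"
      "y1 = A2 *v x1 + e2 + p *\<^sub>R (s x1 *\<^sub>R g + \<mu> *\<^sub>R c)"
      by (rule bimodal_mapE) (auto simp: h s_def)
    from y2 obtain q where q: "0 \<le> q" "q \<le> 1" "s x2 < 0 \<Longrightarrow> q = 1" "s x2 > 0 \<Longrightarrow> q = 0"
      "y2 = A2 *v x2 + e2 + q *\<^sub>R (s x2 *\<^sub>R g + \<mu> *\<^sub>R c)"
      by (rule bimodal_mapE) (auto simp: h s_def)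
    have cz: "c \<bullet> z = s x1 - s x2"
      by (simp add: z_def s_def inner_diff_right)
    \<comment> \<open>On the hyperplane the weight is arbitrary in [0,1], but there it multiplies
      0.\<close>
    have m1: "p * s x1 = min (s x1) 0"
      using p(3,4) by (cases "s x1" "0 :: real" rule: linorder_cases) auto
    have m2: "q * s x2 = min (s x2) 0"
      using q(3,4) by (cases "s x2" "0 :: real" rule: linorder_cases) auto
    have "q \<le> p" if "s x1 < s x2"
      using p(1-4) q(1-4) that by (cases "s x1 < 0") auto
    moreover have "p \<le> q" if "s x2 < s x1"
      using p(1-4) q(1-4) that by (cases "s x2 < 0") auto
    \<comment> \<open>If \<open>s x1 = s x2\<close>, the weights may differ, but the second factor
      vanishes.\<close>
    ultimately have "(p - q) * (s x1 - s x2) \<le> 0"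
      by (cases "s x1" "s x2" rule: linorder_cases) (auto simp: mult_le_0_iff)
    then have step: "\<mu> * ((p - q) * (c \<bullet> z)) \<le> 0"
      using \<mu> by (simp add: cz mult_nonneg_nonpos)
    have "y1 - y2 = A2 *v z + (p * s x1 - q * s x2) *\<^sub>R g + (\<mu> * (p - q)) *\<^sub>R c"
      by (simp add: p(5) q(5) z_def algebra_simps)
    then have "z \<bullet> (y1 - y2) =
        z \<bullet> (A2 *v z) + (p * s x1 - q * s x2) * (z \<bullet> g) + \<mu> * ((p - q) * (c \<bullet> z))"
      by (simp add: inner_add_right inner_commute)
    also have "\<dots> \<le> z \<bullet> (A2 *v z) + (p * s x1 - q * s x2) * (z \<bullet> g)"
      using step by simp
    also have "\<dots> \<le> norm z * (onorm ((*v) A2) * norm z) + (norm c * norm z) * (norm z * norm g)"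
    proof (rule add_mono)
      have "z \<bullet> (A2 *v z) \<le> norm z * norm (A2 *v z)"
        by (rule norm_cauchy_schwarz)
      also have "\<dots> \<le> norm z * (onorm ((*v) A2) * norm z)"
        by (intro mult_left_mono onorm matrix_vector_mul_bounded_linear) simp
      finally show "z \<bullet> (A2 *v z) \<le> norm z * (onorm ((*v) A2) * norm z)" .
      \<comment> \<open>Truncation at 0 from above is 1-Lipschitz.\<close>
      have "\<bar>p * s x1 - q * s x2\<bar> \<le> \<bar>c \<bullet> z\<bar>"
        unfolding m1 m2 cz by linarith
      also have "\<dots> \<le> norm c * norm z"
        by (rule Cauchy_Schwarz_ineq2)
      finally have "\<bar>p * s x1 - q * s x2\<bar> * \<bar>z \<bullet> g\<bar> \<le> (norm c * norm z) * (norm z * norm g)"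
        by (intro mult_mono Cauchy_Schwarz_ineq2) auto
      then show "(p * s x1 - q * s x2) * (z \<bullet> g) \<le> (norm c * norm z) * (norm z * norm g)"
        unfolding abs_mult[symmetric] by (rule abs_le_D1)
    qed
    also have "\<dots> = L * (norm z)\<^sup>2"
      by (simp add: L_def power2_eq_square algebra_simps)
    finally show ?thesis
      by (simp add: z_def)
  qed
  then show ?thesis
    unfolding one_sided_lipschitz_iff by blast
qed

text \<open>The hypothesis excludes \<open>c = 0\<close> with nonzero \<open>f\<close>: there the
  mapping is a single affine branch, hence one-sided Lipschitz for any matrices, while the
  right-hand side would force \<open>A1 = A2\<close>.\<close>

theorem theorem2p6:
  fixes A1 A2 :: "real^'n^'n" and e1 e2 c :: "real^'n" and f :: real
  assumes "c = 0 \<longrightarrow> f = 0"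
  shows "one_sided_lipschitz (bimodal_map A1 A2 e1 e2 c f) \<longleftrightarrow>
    (\<exists>(g :: real^'n) (\<mu> :: real). \<mu> \<ge> 0 \<and>
       A1 - A2 = (columnvector g :: real^1^'n) ** (rowvector c :: real^'n^1) \<and>
       e1 - e2 = f *\<^sub>R g + \<mu> *\<^sub>R c)"
proof
  assume "one_sided_lipschitz (bimodal_map A1 A2 e1 e2 c f)"
  then show "\<exists>g \<mu>. \<mu> \<ge> 0 \<and>
      A1 - A2 = (columnvector g :: real^1^'n) ** (rowvector c :: real^'n^1) \<and>
      e1 - e2 = f *\<^sub>R g + \<mu> *\<^sub>R c"
    using assms
    by (rule rank_one_jump_if_one_sided_lipschitz) (unfold matrix_eq_column_row_iff, blast)
next
  assume "\<exists>g \<mu>. \<mu> \<ge> 0 \<and>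
      A1 - A2 = (columnvector g :: real^1^'n) ** (rowvector c :: real^'n^1) \<and>
      e1 - e2 = f *\<^sub>R g + \<mu> *\<^sub>R c"
  then show "one_sided_lipschitz (bimodal_map A1 A2 e1 e2 c f)"
    unfolding matrix_eq_column_row_iff by (blast intro: one_sided_lipschitz_if_rank_one_jump)
qed

end
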